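(* Let $(\bar x,\bar\lambda)\in\mathbb{R}^n\times\mathbb{R}^{m+1}$ be a solution to the KKT system $$\nabla f(x)+\nabla\Phi(x)^*\lambda=0,\qquad \lambda\in N_{\mathcal Q}(\Phi(x)),$$ and let the second-order sufficient condition (SOSC, see context) hold at $(\bar x,\bar\lambda)$. Assume in addition that either the Lagrange multiplier set $\Lambda(\bar x)$ is a polyhedron, or the multiplier $\bar\lambda$ belongs to the interior of $-\mathcal Q$. Then there are positive constants $\rho_{\bar\lambda},\gamma_{\bar\lambda},\varepsilon_{\bar\lambda},\ell_{\bar\lambda}$ such that for all $\lambda\in\Lambda(\bar x)\cap\mathbb{B}_{\varepsilon_{\bar\lambda}}(\bar\lambda)$ and all $\rho\ge\rho_{\bar\lambda}$ we have the uniform second-order growth condition $$\mathscr{L}(x,\lambda,\rho)\ge f(\bar x)+\ell_{\bar\lambda}\|x-\bar x\|^2\quad\text{whenever }x\in\mathbb{B}_{\gamma_{\bar\lambda}}(\bar x).$$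
   Context: Setting: the second-order cone program "minimize $f(x)$ subject to $\Phi(x)\in\mathcal Q$", where $f:\mathbb{R}^n\to\mathbb{R}$ and $\Phi:\mathbb{R}^n\to\mathbb{R}^{m+1}$ are twice continuously differentiable around the reference point $\bar x$, and $\mathcal Q:=\{y=(y_0,y_r)\in\mathbb{R}\times\mathbb{R}^m\mid\|y_r\|\le y_0\}$. $\mathbb{B}_\gamma(z)$ is the closed ball of radius $\gamma$ centered at $z$; $A^*$ is the transpose of $A$. The Lagrangian is $L(x,\lambda):=f(x)+\langle\lambda,\Phi(x)\rangle$, and the augmented Lagrangian is $$\mathscr{L}(x,\lambda,\rho):=f(x)+\tfrac{\rho}{2}\mathrm{dist}^2\big(\Phi(x)+\rho^{-1}\lambda;\mathcal Q\big)-\tfrac12\rho^{-1}\|\lambda\|^2,\quad(x,\lambda,\rho)\in\mathbb{R}^n\times\mathbb{R}^{m+1}\times(0,\infty).$$ $T_{\mathcal Q}$, $N_{\mathcal Q}$ are the tangent cone and the convex-analysis normal cone to $\mathcal Q$; for $y\in\mathcal Q$, $v\in N_{\mathcal Q}(y)$ the critical cone is $K_{\mathcal Q}(y,v):=T_{\mathcal Q}(y)\cap\{v\}^\perp$. $\delta_{\mathcal Q}$ is the indicator function of $\mathcal Q$. The set of Lagrange multipliers is $\Lambda(\bar x):=\{\lambda\in\mathbb{R}^{m+1}\mid\nabla_xL(\bar x,\lambda)=0,\ \lambda\in N_{\mathcal Q}(\Phi(\bar x))\}$. For $\varphi:\mathbb{R}^p\to(-\infty,\infty]$ with $\varphi(\bar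 z)$ finite and $\bar v\in\mathbb{R}^p$, the second subderivative of $\varphi$ at $\bar z$ for $\bar v$ is $$\mathrm{d}^2\varphi(\bar z,\bar v)(w):=\liminf_{t\downarrow0,\;w'\to w}\frac{\varphi(\bar z+tw')-\varphi(\bar z)-t\langle\bar v,w'\rangle}{\tfrac12t^2}.$$ SOSC at $(\bar x,\bar\lambda)$: $\langle\nabla^2_{xx}L(\bar x,\bar\lambda)w,w\rangle+\mathrm{d}^2\delta_{\mathcal Q}(\Phi(\bar x),\bar\lambda)(\nabla\Phi(\bar x)w)>0$ for all $w\in\mathbb{R}^n\setminus\{0\}$ with $\nabla\Phi(\bar x)w\in K_{\mathcal Q}(\Phi(\bar x),\bar\lambda)$. *)

theory Defs
  imports "HOL-Analysis.Analysis"
begin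

section \<open>Second-order cone programs\<close>

text \<open>
  The space of dimension \<open>m + 1\<close> is \<open>real \<times> (real ^ 'm)\<close>, whose inner product and norm are the
  Euclidean ones; the first component is \<open>y\<^sub>0\<close> and the second one is \<open>y\<^sub>r\<close>.
\<close>

definition soc :: "(real \<times> (real ^ 'm)) set" where
  "soc = {(y0, yr). norm yr \<le> y0}"


subsection \<open>Derivatives\<close>

definition grad :: "('a::euclidean_space \<Rightarrow> real) \<Rightarrow> 'a \<Rightarrow> 'a" where
  "grad f x = (THE D. GDERIV f x :> D)"

text \<open>The Jacobian is used as a linear map; its transpose is \<^const>\<open>adjoint\<close>.\<close>

abbreviation jacobian :: "('a::euclidean_space \<Rightarrow> 'b::euclidean_space) \<Rightarrow> 'a \<Rightarrow> 'a \<Rightarrow> 'b" where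
  "jacobian g x \<equiv> frechet_derivative g (at x)"

definition hessian :: "('a::euclidean_space \<Rightarrow> real) \<Rightarrow> 'a \<Rightarrow> 'a \<Rightarrow> 'a" where
  "hessian f x = jacobian (grad f) x"

definition C2_around :: "('a::euclidean_space \<Rightarrow> 'b::euclidean_space) \<Rightarrow> 'a \<Rightarrow> bool" where
  "C2_around g x \<longleftrightarrow>
     (\<exists>U (g' :: 'a \<Rightarrow> 'a \<Rightarrow>\<^sub>L 'b) (g'' :: 'a \<Rightarrow> 'a \<Rightarrow>\<^sub>L ('a \<Rightarrow>\<^sub>L 'b)).
        open U \<and> x \<in> U \<and>
        (\<forall>y\<in>U. (g has_derivative blinfun_apply (g' y)) (at y)) \<and>
        (\<forall>y\<in>U. (g' has_derivative blinfun_apply (g'' y)) (at y)) \<and>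
        continuous_on U g'')"


subsection \<open>Variational geometry\<close>

definition tangent_cone :: "'a::euclidean_space set \<Rightarrow> 'a \<Rightarrow> 'a set" where
  "tangent_cone S y =
     {w. \<exists>(t :: nat \<Rightarrow> real) u. (\<forall>k. 0 < t k) \<and> t \<longlonglongrightarrow> 0 \<and> u \<longlonglongrightarrow> w \<and> (\<forall>k. y + t k *\<^sub>R u k \<in> S)}"

text \<open>The normal cone of convex analysis, empty at points outside the set; thus
  \<open>v \<in> normal_cone S y\<close> entails \<open>y \<in> S\<close>.\<close>

definition normal_cone :: "'a::euclidean_space set \<Rightarrow> 'a \<Rightarrow> 'a set" where
  "normal_cone S y = {v. y \<in> S \<and> (\<forall>z\<in>S. v \<bullet> (z - y) \<le> 0)}"

definition critical_cone :: "'a::euclidean_space set \<Rightarrow> 'a \<Rightarrow> 'a \<Rightarrow> 'a set" where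
  "critical_cone S y v = tangent_cone S y \<inter> {w. v \<bullet> w = 0}"

definition ind_fun :: "'a set \<Rightarrow> 'a \<Rightarrow> ereal" where
  "ind_fun S y = (if y \<in> S then 0 else \<infinity>)"

text \<open>The filter \<open>nhds w\<close>, rather than \<open>at w\<close>, is used because \<open>w' = w\<close> is admitted in the
  lower limit.\<close>

definition second_subderiv :: "('a::euclidean_space \<Rightarrow> ereal) \<Rightarrow> 'a \<Rightarrow> 'a \<Rightarrow> 'a \<Rightarrow> ereal" where
  "second_subderiv \<phi> z v w =
     Liminf (at_right 0 \<times>\<^sub>F nhds w)
       (\<lambda>(t, w'). (\<phi> (z + t *\<^sub>R w') - \<phi> z - ereal (t * (v \<bullet> w'))) / ereal (t\<^sup>2 / 2))"


subsection \<open>Lagrangians, multipliers and optimality conditions\<close>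

definition lagrangian ::
  "(real ^ 'n \<Rightarrow> real) \<Rightarrow> (real ^ 'n \<Rightarrow> real \<times> (real ^ 'm)) \<Rightarrow> real ^ 'n \<Rightarrow> real \<times> (real ^ 'm) \<Rightarrow> real"
where
  "lagrangian f \<Phi> x lam = f x + lam \<bullet> \<Phi> x"

definition aug_lagrangian ::
  "(real ^ 'n \<Rightarrow> real) \<Rightarrow> (real ^ 'n \<Rightarrow> real \<times> (real ^ 'm)) \<Rightarrow>
   real ^ 'n \<Rightarrow> real \<times> (real ^ 'm) \<Rightarrow> real \<Rightarrow> real"
where
  "aug_lagrangian f \<Phi> x lam \<rho> =
     f x + \<rho> / 2 * (infdist (\<Phi> x + inverse \<rho> *\<^sub>R lam) soc)\<^sup>2 - 1 / 2 * inverse \<rho> * (norm lam)\<^sup>2"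

definition multipliers ::
  "(real ^ 'n \<Rightarrow> real) \<Rightarrow> (real ^ 'n \<Rightarrow> real \<times> (real ^ 'm)) \<Rightarrow> real ^ 'n \<Rightarrow> (real \<times> (real ^ 'm)) set"
where
  "multipliers f \<Phi> x =
     {lam. grad (\<lambda>x. lagrangian f \<Phi> x lam) x = 0 \<and> lam \<in> normal_cone soc (\<Phi> x)}"

definition KKT ::
  "(real ^ 'n \<Rightarrow> real) \<Rightarrow> (real ^ 'n \<Rightarrow> real \<times> (real ^ 'm)) \<Rightarrow> real ^ 'n \<Rightarrow> real \<times> (real ^ 'm) \<Rightarrow> bool"
where
  "KKT f \<Phi> x lam \<longleftrightarrow>
     grad f x + adjoint (jacobian \<Phi> x) lam = 0 \<and> lam \<in> normal_cone soc (\<Phi> x)"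

definition SOSC ::
  "(real ^ 'n \<Rightarrow> real) \<Rightarrow> (real ^ 'n \<Rightarrow> real \<times> (real ^ 'm)) \<Rightarrow> real ^ 'n \<Rightarrow> real \<times> (real ^ 'm) \<Rightarrow> bool"
where
  "SOSC f \<Phi> x lam \<longleftrightarrow>
     (\<forall>w. w \<noteq> 0 \<longrightarrow> jacobian \<Phi> x w \<in> critical_cone soc (\<Phi> x) lam \<longrightarrow>
        ereal (hessian (\<lambda>x. lagrangian f \<Phi> x lam) x w \<bullet> w)
          + second_subderiv (ind_fun soc) (\<Phi> x) lam (jacobian \<Phi> x w) > 0)"

end

theory Submission
  imports Defs
begin

text \<open>
  The augmented Lagrangian is the minimum over \<open>q \<in> Q\<close> of
  \<open>f x + lam \<bullet> (\<Phi> x - q) + \<rho>/2 * |\<Phi> x - q|\<^sup>2\<close>, hence nondecreasing in \<open>\<rho>\<close>. If uniform growth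
  fails, there are multipliers \<open>lam\<^sub>k\<close>, points \<open>x\<^sub>k\<close> and \<open>q\<^sub>k \<in> Q\<close> violating it along \<open>\<rho>\<^sub>k \<rightarrow> \<infinity>\<close>.
  With \<open>t\<^sub>k = |x\<^sub>k - xbar|\<close>, the penalty forces \<open>|\<Phi> x\<^sub>k - q\<^sub>k| = o(t\<^sub>k)\<close>, so that the directions of
  \<open>x\<^sub>k - xbar\<close> cluster at some \<open>w\<close> whose image under the Jacobian is critical, and \<open>q\<^sub>k\<close> produces
  difference quotients for the second subderivative there. The only obstacle is that these quotients
  involve \<open>lam\<^sub>k\<close> instead of \<open>lambar\<close>. Either alternative of the last hypothesis yields
  \<open>lam - (1 - \<delta>) lambar \<in> N\<close> for every \<open>\<delta> > 0\<close> and all multipliers \<open>lam\<close> close to \<open>lambar\<close>,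
  where \<open>N\<close> is the normal cone at \<open>\<Phi> xbar\<close>, which bounds the quotients for \<open>lam\<^sub>k\<close> below by
  \<open>1 - \<delta>\<close> times those for \<open>lambar\<close>; letting \<open>\<delta> \<rightarrow> 0\<close> contradicts SOSC.
\<close>

section \<open>Second-order Taylor expansion, gradients and Hessians\<close>

text \<open>Follows from the mean value inequality on the segment from \<open>x\<close> to
  \<open>y\<close>, applied to \<open>g\<close> minus its quadratic model. The filter is
  \<open>nhds x\<close>, not \<open>at x\<close>: at \<open>y = x\<close> the quotient is 0 because
  dividing by zero gives 0, so the limit composes with any sequence tending to
  \<open>x\<close>.\<close>

lemma second_order_taylor:
  fixes g :: "'a::real_normed_vector \<Rightarrow> 'b::real_normed_vector"
    and g' :: "'a \<Rightarrow> 'a \<Rightarrow>\<^sub>L 'b"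
  assumes der: "\<forall>\<^sub>F y in nhds x. (g has_derivative blinfun_apply (g' y)) (at y)"
    and der2: "(g' has_derivative blinfun_apply g'') (at x)"
  shows "((\<lambda>y. (g y - g x - g' x (y - x) - (1/2) *\<^sub>R g'' (y - x) (y - x)) /\<^sub>R (norm (y - x))\<^sup>2)
            \<longlongrightarrow> 0) (nhds x)"
proof (rule tendstoI)
  fix e :: real assume "e > 0"
  define e' where "e' = e / 2"
  have "e' > 0" "e' < e" using \<open>e > 0\<close> by (auto simp: e'_def)
  obtain d1 where d1: "d1 > 0"
    "\<And>y. dist y x < d1 \<Longrightarrow> (g has_derivative blinfun_apply (g' y)) (at y)"
    using der unfolding eventually_nhds_metric by blast
  obtain d2 where d2: "d2 > 0"
    "\<And>y. norm (y - x) < d2 \<Longrightarrow> norm (g' y - g' x - g'' (y - x)) \<le> e' * norm (y - x)"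
    using der2 \<open>e' > 0\<close> unfolding has_derivative_at_alt by blast
  have bound: "norm (g y - g x - g' x (y - x) - (1/2) *\<^sub>R g'' (y - x) (y - x)) \<le> e' * (norm (y - x))\<^sup>2"
    if y: "dist y x < min d1 d2" for y
  proof -
    define v where "v = y - x"
    \<comment> \<open>The quadratic model is subtracted along the segment, so that
      \<open>h 1 - h 0\<close> is exactly the Taylor remainder at \<open>y\<close>.\<close>
    define h where "h = (\<lambda>s::real. g (x + s *\<^sub>R v) - s *\<^sub>R g' x v - (s\<^sup>2/2) *\<^sub>R g'' v v)"
    define h' where "h' = (\<lambda>s::real. g' (x + s *\<^sub>R v) v - g' x v - s *\<^sub>R g'' v v)"
    have near: "norm (s *\<^sub>R v) < min d1 d2" if "s \<in> {0..1}" for s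
      using y that mult_left_le_one_le[of "norm v" "\<bar>s\<bar>"] by (auto simp: v_def dist_norm)
    have "(h has_derivative (\<lambda>r. r *\<^sub>R h' s)) (at s within {0..1})" if s: "s \<in> {0..1}" for s
    proof -
      have "(g has_derivative blinfun_apply (g' (x + s *\<^sub>R v))) (at (x + s *\<^sub>R v))"
        using d1(2) near[OF s] by (simp add: dist_norm)
      then have "((\<lambda>s. g (x + s *\<^sub>R v)) has_derivative (\<lambda>r. g' (x + s *\<^sub>R v) (r *\<^sub>R v)))
          (at s within {0..1})"
        by (rule has_derivative_compose[rotated]) (auto intro!: derivative_eq_intros)
      then show ?thesis
        unfolding h_def h'_def
        by (auto intro!: derivative_eq_intros simp: blinfun.scaleR_right algebra_simps)
    qed
    moreover have "onorm (\<lambda>r. r *\<^sub>R h' s) \<le> e' * (norm v)\<^sup>2" if s: "s \<in> {0..1}" for s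
    proof (rule onorm_le)
      fix r :: real
      have "h' s = (g' (x + s *\<^sub>R v) - g' x - g'' (s *\<^sub>R v)) v"
        by (simp add: h'_def blinfun.diff_left blinfun.scaleR_right blinfun.scaleR_left)
      then have "norm (h' s) \<le> norm (g' (x + s *\<^sub>R v) - g' x - g'' (s *\<^sub>R v)) * norm v"
        by (simp add: norm_blinfun)
      also have "\<dots> \<le> (e' * norm (s *\<^sub>R v)) * norm v"
        using d2(2)[of "x + s *\<^sub>R v"] near[OF s] by (intro mult_right_mono) auto
      also have "\<dots> \<le> (e' * norm v) * norm v"
        using s \<open>e' > 0\<close> mult_left_le_one_le[of "norm v" "\<bar>s\<bar>"]
        by (intro mult_right_mono mult_left_mono) auto
      finally show "norm (r *\<^sub>R h' s) \<le> e' * (norm v)\<^sup>2 * norm r"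
        using mult_left_mono[of "norm (h' s)" "e' * (norm v)\<^sup>2" "\<bar>r\<bar>"]
        by (simp add: power2_eq_square algebra_simps)
    qed
    ultimately have "norm (h 1 - h 0) \<le> e' * (norm v)\<^sup>2 * norm (1 - 0 :: real)"
      by (intro differentiable_bound[of "{0..1}" h "\<lambda>s r. r *\<^sub>R h' s"]) auto
    then show ?thesis
      by (simp add: h_def v_def algebra_simps)
  qed
  have "norm ((g y - g x - g' x (y - x) - (1/2) *\<^sub>R g'' (y - x) (y - x)) /\<^sub>R (norm (y - x))\<^sup>2) < e"
    if "dist y x < min d1 d2" for y
  proof (cases "y = x")
    case False
    have "norm (g y - g x - g' x (y - x) - (1/2) *\<^sub>R g'' (y - x) (y - x)) < e * (norm (y - x))\<^sup>2"
      using bound[OF that] False \<open>e' < e\<close> by (elim order.strict_trans1) (simp add: mult_strict_right_mono)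
    then show ?thesis
      using False by (simp add: divide_simps mult.commute)
  qed (use \<open>e > 0\<close> in simp)
  then show "\<forall>\<^sub>F y in nhds x. dist ((g y - g x - g' x (y - x) - (1/2) *\<^sub>R g'' (y - x) (y - x)) /\<^sub>R (norm (y - x))\<^sup>2) 0 < e"
    unfolding eventually_nhds_metric using d1(1) d2(1) by (intro exI[of _ "min d1 d2"]) auto
qed

lemma GDERIV_grad:
  assumes "GDERIV f x :> D"
  shows "grad f x = D"
  unfolding grad_def
proof (rule the_equality)
  fix D' assume "GDERIV f x :> D'"
  then have "(\<lambda>h. h \<bullet> D') = (\<lambda>h. h \<bullet> D)"
    using assms unfolding gderiv_def by (rule has_derivative_unique)
  then have "h \<bullet> D' = h \<bullet> D" for h
    by (simp add: fun_eq_iff)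
  then show "D' = D"
    using vector_eq_ldot[of D' D] by simp
qed (fact assms)

text \<open>The Riesz representer in coordinates; it gives an explicit formula for the
  gradient.\<close>

lemma linear_functional_inner:
  fixes F :: "'a::euclidean_space \<Rightarrow> real"
  assumes "linear F"
  shows "F h = h \<bullet> (\<Sum>b\<in>Basis. F b *\<^sub>R b)"
proof -
  have "F h = F (\<Sum>b\<in>Basis. (h \<bullet> b) *\<^sub>R b)"
    by (simp only: euclidean_representation)
  also have "\<dots> = h \<bullet> (\<Sum>b\<in>Basis. F b *\<^sub>R b)"
    by (simp add: linear_sum[OF assms] linear_cmul[OF assms] inner_sum_right mult.commute)
  finally show ?thesis .
qed

lemma has_derivative_grad:
  fixes f :: "'a::euclidean_space \<Rightarrow> real"
  assumes "(f has_derivative f') (at x)"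
  shows "grad f x = (\<Sum>b\<in>Basis. f' b *\<^sub>R b)"
proof (rule GDERIV_grad)
  have "(\<lambda>h. h \<bullet> (\<Sum>b\<in>Basis. f' b *\<^sub>R b)) = f'"
    by (simp only: linear_functional_inner[OF has_derivative_linear[OF assms], symmetric])
  then show "GDERIV f x :> (\<Sum>b\<in>Basis. f' b *\<^sub>R b)"
    using assms by (simp only: gderiv_def)
qed

lemma inner_grad:
  fixes f :: "'a::euclidean_space \<Rightarrow> real"
  assumes "(f has_derivative f') (at x)"
  shows "h \<bullet> grad f x = f' h"
  unfolding has_derivative_grad[OF assms]
  by (rule linear_functional_inner[OF has_derivative_linear[OF assms], symmetric])

text \<open>Near \<open>x\<close> the gradient is the image of \<open>f'\<close> under the fixed
  linear map taking a functional to its Riesz representer. Differentiating through that map turns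
  \<open>f''\<close> into the Hessian.\<close>

lemma inner_hessian:
  fixes f :: "'a::euclidean_space \<Rightarrow> real" and f' :: "'a \<Rightarrow> 'a \<Rightarrow>\<^sub>L real"
  assumes der: "\<forall>\<^sub>F y in nhds x. (f has_derivative blinfun_apply (f' y)) (at y)"
    and der2: "(f' has_derivative f'') (at x)"
  shows "h \<bullet> hessian f x w = f'' w h"
proof -
  have sum_der: "((\<lambda>y. \<Sum>b\<in>Basis. f' y b *\<^sub>R b) has_derivative (\<lambda>w. \<Sum>b\<in>Basis. f'' w b *\<^sub>R b)) (at x)"
    using der2 by (auto intro!: derivative_eq_intros)
  obtain S where open_S: "open S" "x \<in> S"
    and S: "\<And>y. y \<in> S \<Longrightarrow> (f has_derivative blinfun_apply (f' y)) (at y)"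
    using der unfolding eventually_nhds by blast
  have "(grad f has_derivative (\<lambda>w. \<Sum>b\<in>Basis. f'' w b *\<^sub>R b)) (at x)"
    by (rule has_derivative_transform_within_open[OF sum_der open_S]) (simp add: has_derivative_grad[OF S])
  then have "hessian f x w = (\<Sum>b\<in>Basis. f'' w b *\<^sub>R b)"
    by (simp add: hessian_def frechet_derivative_at[symmetric])
  moreover have "linear (f'' w)"
    by (simp add: blinfun.bounded_linear_right bounded_linear.linear)
  ultimately show ?thesis
    by (simp add: linear_functional_inner[symmetric])
qed

lemma C2_aroundE:
  assumes "C2_around g x"
  obtains g' :: "'a::euclidean_space \<Rightarrow> 'a \<Rightarrow>\<^sub>L 'b::euclidean_space" and g''
  where "\<forall>\<^sub>F y in nhds x. (g has_derivative blinfun_apply (g' y)) (at y)"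
    and "(g' has_derivative blinfun_apply g'') (at x)"
  using assms unfolding C2_around_def eventually_nhds by metis

section \<open>The second-order cone, normal cones and extension of multiplier segments\<close>

lemma infdist_attained_on_soc:
  obtains q where "q \<in> soc" "infdist z soc = dist z (q :: real \<times> (real ^ 'm))"
proof -
  have "soc = {y :: real \<times> (real ^ 'm). norm (snd y) \<le> fst y}"
    by (auto simp: soc_def)
  moreover have "closed {y :: real \<times> (real ^ 'm). norm (snd y) \<le> fst y}"
    by (intro closed_Collect_le continuous_intros)
  ultimately have "closed (soc :: (real \<times> (real ^ 'm)) set)"
    by simp
  moreover have "(0 :: real \<times> (real ^ 'm)) \<in> soc"
    by (simp add: soc_def zero_prod_def)
  ultimately show thesis
    using infdist_attains_inf[of soc z] that by blast
qed

lemma normal_cone_scaleR: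
  assumes "v \<in> normal_cone S y" "c \<ge> 0"
  shows "c *\<^sub>R v \<in> normal_cone S y"
  using assms by (auto simp: normal_cone_def mult_nonneg_nonpos)

text \<open>Each half-space is treated separately. If it is active at \<open>a\<close>, the slack is
  merely multiplied by \<open>c\<close>; if it is inactive, its strict inequality persists near
  \<open>a\<close> by continuity. Finiteness of the family gives a common neighbourhood, even when
  \<open>c > 1\<close>.\<close>

lemma polyhedron_extend_segment:
  fixes a :: "'a::euclidean_space"
  assumes "polyhedron S" "a \<in> S" "c \<ge> 0"
  shows "\<forall>\<^sub>F x in nhds a. x \<in> S \<longrightarrow> a + c *\<^sub>R (x - a) \<in> S"
proof -
  obtain F where F: "finite F" "S = \<Inter>F" "\<And>h. h \<in> F \<Longrightarrow> \<exists>n b. h = {x. n \<bullet> x \<le> b}"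
    using assms(1) unfolding polyhedron_def by metis
  have "\<forall>\<^sub>F x in nhds a. x \<in> h \<longrightarrow> a + c *\<^sub>R (x - a) \<in> h" if "h \<in> F" for h
  proof -
    obtain n b where h: "h = {x. n \<bullet> x \<le> b}"
      using F(3)[OF \<open>h \<in> F\<close>] by blast
    have "a \<in> h"
      using assms(2) F(2) \<open>h \<in> F\<close> by simp
    then have "n \<bullet> a \<le> b"
      by (simp add: h)
    then consider "n \<bullet> a = b" | "n \<bullet> a < b"
      by linarith
    then show ?thesis
    proof cases
      case 1
      then have "n \<bullet> (a + c *\<^sub>R (x - a)) = b + c * (n \<bullet> x - b)" for x
        by (simp add: inner_add_right inner_diff_right)
      then show ?thesis
        using \<open>c \<ge> 0\<close> by (intro always_eventually) (auto simp: h mult_nonneg_nonpos)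
    next
      case 2
      have "((\<lambda>x. n \<bullet> (a + c *\<^sub>R (x - a))) \<longlongrightarrow> n \<bullet> (a + c *\<^sub>R (a - a))) (nhds a)"
        by (intro tendsto_intros filterlim_ident)
      then have "\<forall>\<^sub>F x in nhds a. n \<bullet> (a + c *\<^sub>R (x - a)) < b"
        using 2 by (auto dest: order_tendstoD)
      then show ?thesis
        by (rule eventually_mono) (simp add: h)
    qed
  qed
  then have "\<forall>\<^sub>F x in nhds a. \<forall>h\<in>F. x \<in> h \<longrightarrow> a + c *\<^sub>R (x - a) \<in> h"
    by (intro eventually_ball_finite[OF F(1)]) blast
  then show ?thesis
    by (rule eventually_mono) (auto simp: F(2))
qed

text \<open>One half of the self-duality of the cone, by Cauchy-Schwarz.\<close>

lemma inner_soc_nonneg: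
  assumes "y \<in> soc" "z \<in> soc"
  shows "y \<bullet> z \<ge> 0"
proof -
  obtain y0 yr z0 zr where [simp]: "y = (y0, yr)" "z = (z0, zr)"
    by (metis surj_pair)
  have "norm yr * norm zr \<le> y0 * z0"
    using assms norm_ge_zero[of yr] by (intro mult_mono) (auto simp: soc_def intro: order_trans[OF norm_ge_zero])
  moreover have "- (yr \<bullet> zr) \<le> norm yr * norm zr"
    using Cauchy_Schwarz_ineq2[of yr zr] by linarith
  ultimately show ?thesis
    by simp
qed

lemma normal_cone_extend_soc:
  fixes lambar :: "real \<times> (real ^ 'm)"
  assumes y: "lambar \<in> normal_cone soc y" and int: "lambar \<in> interior (uminus ` soc)"
    and "\<delta> > 0"
  shows "\<forall>\<^sub>F lam in nhds lambar. lam - (1 - \<delta>) *\<^sub>R lambar \<in> normal_cone soc y"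
proof -
  have int_ev: "\<forall>\<^sub>F v in nhds lambar. v \<in> uminus ` soc"
    using eventually_nhds_in_open[OF open_interior int]
    by (rule eventually_mono) (use interior_subset in blast)
  have zero: "(0 :: real \<times> (real ^ 'm)) \<in> soc"
    by (simp add: soc_def zero_prod_def)
  have "y = 0"
  proof (rule ccontr)
    assume "y \<noteq> 0"
    have "((\<lambda>s. lambar + s *\<^sub>R y) \<longlongrightarrow> lambar + 0 *\<^sub>R y) (at_right (0::real))"
      by (intro tendsto_intros)
    then have "\<forall>\<^sub>F s in at_right (0::real). lambar + s *\<^sub>R y \<in> uminus ` soc"
      using eventually_compose_filterlim[OF int_ev] by simp
    then have "\<forall>\<^sub>F s in at_right (0::real). lambar + s *\<^sub>R y \<in> uminus ` soc \<and> s > 0"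
      by (simp add: eventually_conj eventually_at_right_less)
    then obtain s where s: "lambar + s *\<^sub>R y \<in> uminus ` soc" "s > 0"
      using eventually_happens'[OF trivial_limit_at_right_real] by blast
    obtain z where z: "z \<in> soc" "lambar + s *\<^sub>R y = - z"
      using s(1) by blast
    have "y \<in> soc"
      using y by (simp add: normal_cone_def)
    then have "(lambar + s *\<^sub>R y) \<bullet> y \<le> 0"
      using inner_soc_nonneg[OF z(1)] by (simp add: z(2))
    moreover have "lambar \<bullet> y \<ge> 0"
      using y zero by (force simp: normal_cone_def)
    moreover have "s * (y \<bullet> y) > 0"
      using \<open>s > 0\<close> \<open>y \<noteq> 0\<close> by simp
    ultimately show False
      by (simp add: inner_add_left)
  qed
  have "((\<lambda>lam. (lam - (1 - \<delta>) *\<^sub>R lambar) /\<^sub>R \<delta>) \<longlongrightarrow> (lambar - (1 - \<delta>) *\<^sub>R lambar) /\<^sub>R \<delta>) (nhds lambar)"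
    by (intro tendsto_intros filterlim_ident)
  moreover have "(lambar - (1 - \<delta>) *\<^sub>R lambar) /\<^sub>R \<delta> = lambar"
    using \<open>\<delta> > 0\<close> by (simp flip: scaleR_left.diff add: algebra_simps)
  ultimately have "\<forall>\<^sub>F lam in nhds lambar. (lam - (1 - \<delta>) *\<^sub>R lambar) /\<^sub>R \<delta> \<in> uminus ` soc"
    using eventually_compose_filterlim[OF int_ev] by simp
  then show ?thesis
  proof (rule eventually_mono)
    fix lam assume "(lam - (1 - \<delta>) *\<^sub>R lambar) /\<^sub>R \<delta> \<in> uminus ` soc"
    then obtain z where "z \<in> soc" "(lam - (1 - \<delta>) *\<^sub>R lambar) /\<^sub>R \<delta> = - z"
      by blast
    then have "(lam - (1 - \<delta>) *\<^sub>R lambar) /\<^sub>R \<delta> \<in> normal_cone soc y"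
      using inner_soc_nonneg[OF \<open>z \<in> soc\<close>] zero by (simp add: normal_cone_def \<open>y = 0\<close>)
    then show "lam - (1 - \<delta>) *\<^sub>R lambar \<in> normal_cone soc y"
      using normal_cone_scaleR[of _ soc y \<delta>] \<open>\<delta> > 0\<close> by fastforce
  qed
qed

text \<open>The segment from \<open>lambar\<close> to \<open>lam\<close> is prolonged by the factor
  \<open>inverse \<delta>\<close> within \<open>M\<close>; multiplying its new endpoint by
  \<open>\<delta>\<close> gives the required normal vector.\<close>

lemma normal_cone_extend_polyhedron:
  fixes lambar :: "'a::euclidean_space"
  assumes "polyhedron M" "M \<subseteq> normal_cone S y" "lambar \<in> M" "\<delta> > 0"
  shows "\<forall>\<^sub>F lam in nhds lambar. lam \<in> M \<longrightarrow> lam - (1 - \<delta>) *\<^sub>R lambar \<in> normal_cone S y"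
proof -
  have "\<forall>\<^sub>F lam in nhds lambar. lam \<in> M \<longrightarrow> lambar + inverse \<delta> *\<^sub>R (lam - lambar) \<in> M"
    using assms by (intro polyhedron_extend_segment) auto
  then show ?thesis
  proof (rule eventually_mono, intro impI)
    fix lam assume "lam \<in> M \<longrightarrow> lambar + inverse \<delta> *\<^sub>R (lam - lambar) \<in> M" "lam \<in> M"
    then have "\<delta> *\<^sub>R (lambar + inverse \<delta> *\<^sub>R (lam - lambar)) \<in> normal_cone S y"
      using assms(2,4) by (intro normal_cone_scaleR) auto
    also have "\<delta> *\<^sub>R (lambar + inverse \<delta> *\<^sub>R (lam - lambar)) = lam - (1 - \<delta>) *\<^sub>R lambar"
      using assms(4) by (simp add: algebra_simps)
    finally show "lam - (1 - \<delta>) *\<^sub>R lambar \<in> normal_cone S y" .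
  qed
qed

section \<open>The augmented Lagrangian as a penalized value at a point of the cone\<close>

text \<open>Take \<open>q\<close> nearest to the shifted point and expand the square: the squared
  norm of the shift cancels the last term of the augmented Lagrangian.\<close>

lemma aug_lagrangian_attained:
  assumes "\<rho> > 0"
  obtains q where "q \<in> soc"
    "aug_lagrangian f \<Phi> x lam \<rho> = f x + lam \<bullet> (\<Phi> x - q) + \<rho> / 2 * (norm (\<Phi> x - q))\<^sup>2"
proof -
  obtain q where q: "q \<in> soc" "infdist (\<Phi> x + inverse \<rho> *\<^sub>R lam) soc = dist (\<Phi> x + inverse \<rho> *\<^sub>R lam) q"
    by (rule infdist_attained_on_soc)
  have "norm ((\<Phi> x - q) + inverse \<rho> *\<^sub>R lam) ^ 2
      = (norm (\<Phi> x - q))\<^sup>2 + 2 * inverse \<rho> * (lam \<bullet> (\<Phi> x - q)) + (inverse \<rho>)\<^sup>2 * (norm lam)\<^sup>2"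
    unfolding power2_norm_eq_inner
    by (simp add: inner_add_left inner_add_right inner_commute power2_eq_square)
  then have "(dist (\<Phi> x + inverse \<rho> *\<^sub>R lam) q)\<^sup>2
      = (norm (\<Phi> x - q))\<^sup>2 + 2 * inverse \<rho> * (lam \<bullet> (\<Phi> x - q)) + (inverse \<rho>)\<^sup>2 * (norm lam)\<^sup>2"
    by (simp add: dist_norm algebra_simps)
  moreover have "\<rho> / 2 * (A + 2 * inverse \<rho> * B + (inverse \<rho>)\<^sup>2 * C) - 1 / 2 * inverse \<rho> * C
      = B + \<rho> / 2 * A" for A B C :: real
    using assms by (simp add: power2_eq_square field_simps)
  ultimately have "aug_lagrangian f \<Phi> x lam \<rho> = f x + lam \<bullet> (\<Phi> x - q) + \<rho> / 2 * (norm (\<Phi> x - q))\<^sup>2"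
    unfolding aug_lagrangian_def q(2) by (smt (verit))
  then show thesis
    using q(1) that by blast
qed

section \<open>Uniform growth, by contradiction along sequences\<close>

text \<open>A single \<open>e\<close> serves as both radii, as growth modulus and as reciprocal of
  the penalty parameter, so the negation yields one sequence indexed by \<open>e n\<close>. Both
  alternatives on the multipliers enter only through \<open>extend\<close>.\<close>

lemma uniform_growth:
  fixes f :: "'a::euclidean_space \<Rightarrow> real" and \<Phi> :: "'a \<Rightarrow> 'b::euclidean_space"
    and f' :: "'a \<Rightarrow> 'a \<Rightarrow>\<^sub>L real" and \<Phi>' :: "'a \<Rightarrow> 'a \<Rightarrow>\<^sub>L 'b"
  assumes f': "\<forall>\<^sub>F x in nhds xbar. (f has_derivative blinfun_apply (f' x)) (at x)"
    and f'': "(f' has_derivative blinfun_apply f'') (at xbar)"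
    and \<Phi>': "\<forall>\<^sub>F x in nhds xbar. (\<Phi> has_derivative blinfun_apply (\<Phi>' x)) (at x)"
    and \<Phi>'': "(\<Phi>' has_derivative blinfun_apply \<Phi>'') (at xbar)"
    and Q: "\<Phi> xbar \<in> Q"
    and stationary: "\<And>lam v. lam \<in> M \<Longrightarrow> f' xbar v + lam \<bullet> \<Phi>' xbar v = 0"
    and normal: "M \<subseteq> normal_cone Q (\<Phi> xbar)"
    and sosc: "\<And>w. w \<noteq> 0 \<Longrightarrow> \<Phi>' xbar w \<in> critical_cone Q (\<Phi> xbar) lambar \<Longrightarrow>
        ereal (f'' w w + lambar \<bullet> \<Phi>'' w w) + second_subderiv (ind_fun Q) (\<Phi> xbar) lambar (\<Phi>' xbar w) > 0"
    and extend: "\<And>\<delta>::real. 0 < \<delta> \<Longrightarrow> \<delta> < 1 \<Longrightarrow>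
        \<forall>\<^sub>F lam in nhds lambar. lam \<in> M \<longrightarrow> lam - (1 - \<delta>) *\<^sub>R lambar \<in> normal_cone Q (\<Phi> xbar)"
  shows "\<exists>e>0. \<forall>lam \<in> M \<inter> cball lambar e. \<forall>x \<in> cball xbar e. \<forall>q \<in> Q.
           f x + lam \<bullet> (\<Phi> x - q) + 1 / (2 * e) * (norm (\<Phi> x - q))\<^sup>2 \<ge> f xbar + e * (norm (x - xbar))\<^sup>2"
proof (rule ccontr)
  assume neg: "\<not> ?thesis"
  define e where "e = (\<lambda>n. inverse (real (Suc n)))"
  have e_pos: "e n > 0" for n by (simp add: e_def)
  have e_lim: "e \<longlonglongrightarrow> 0"
    unfolding e_def by (rule LIMSEQ_inverse_real_of_nat)
  have "\<exists>lam x q. lam \<in> M \<and> dist lambar lam \<le> e n \<and> dist xbar x \<le> e n \<and> q \<in> Q \<and>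
      f x + lam \<bullet> (\<Phi> x - q) + 1 / (2 * e n) * (norm (\<Phi> x - q))\<^sup>2 < f xbar + e n * (norm (x - xbar))\<^sup>2" for n
    using neg e_pos[of n] by (force simp: not_le)
  then obtain Lm X q where seq:
    "\<And>n. Lm n \<in> M" "\<And>n. dist lambar (Lm n) \<le> e n" "\<And>n. dist xbar (X n) \<le> e n" "\<And>n. q n \<in> Q"
    "\<And>n. f (X n) + Lm n \<bullet> (\<Phi> (X n) - q n) + 1 / (2 * e n) * (norm (\<Phi> (X n) - q n))\<^sup>2
        < f xbar + e n * (norm (X n - xbar))\<^sup>2"
    by metis
  have Lm_lim: "Lm \<longlonglongrightarrow> lambar"
    by (rule metric_tendsto_imp_tendsto[OF e_lim always_eventually])
      (use seq(2) e_pos in \<open>simp add: dist_commute less_imp_le\<close>)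
  have X_lim: "X \<longlonglongrightarrow> xbar"
    by (rule metric_tendsto_imp_tendsto[OF e_lim always_eventually])
      (use seq(3) e_pos in \<open>simp add: dist_commute less_imp_le\<close>)
  have slope: "Lm n \<bullet> (q n - \<Phi> xbar) \<le> 0" for n
    using normal seq(1,4) by (force simp: normal_cone_def)
  define t where "t = (\<lambda>n. norm (X n - xbar))"
  \<comment> \<open>At \<open>xbar\<close> itself the multiplier term is nonnegative by
    \<open>slope\<close>, so a violation would make the penalty term negative.\<close>
  have X_neq: "X n \<noteq> xbar" for n
  proof
    assume "X n = xbar"
    then have "1 / (2 * e n) * (norm (\<Phi> xbar - q n))\<^sup>2 < 0"
      using seq(5)[of n] slope[of n] by (simp add: inner_diff_right)
    then show False
      using e_pos[of n] by (simp add: mult_less_0_iff divide_less_0_iff)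
  qed
  then have t_pos: "t n > 0" for n by (simp add: t_def)
  have t_lim: "t \<longlonglongrightarrow> 0"
    unfolding t_def using tendsto_norm[OF LIM_zero[OF X_lim]] by simp
  define W where "W = (\<lambda>n. (X n - xbar) /\<^sub>R t n)"
  have X_W: "X n - xbar = t n *\<^sub>R W n" for n
    using t_pos[of n] by (simp add: W_def)
  have "W n \<in> sphere 0 1" for n
    using t_pos[of n] by (simp add: W_def t_def)
  then obtain w r where w: "w \<in> sphere 0 1" and r: "strict_mono r" and W_lim: "(W \<circ> r) \<longlonglongrightarrow> w"
    using compact_sphere[of "0::'a" 1] unfolding compact_def by metis
  then have "w \<noteq> 0" by auto
  note sub = LIMSEQ_subseq_LIMSEQ[OF _ r, unfolded comp_def]
  define Rf where "Rf = (\<lambda>x. (f x - f xbar - f' xbar (x - xbar) - (1/2) *\<^sub>R f'' (x - xbar) (x - xbar)) /\<^sub>R (norm (x - xbar))\<^sup>2)"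
  define R\<Phi> where "R\<Phi> = (\<lambda>x. (\<Phi> x - \<Phi> xbar - \<Phi>' xbar (x - xbar) - (1/2) *\<^sub>R \<Phi>'' (x - xbar) (x - xbar)) /\<^sub>R (norm (x - xbar))\<^sup>2)"
  have Rf_lim: "(\<lambda>n. Rf (X n)) \<longlonglongrightarrow> 0"
    using filterlim_compose[OF second_order_taylor[OF f' f''] X_lim] by (simp add: Rf_def)
  have R\<Phi>_lim: "(\<lambda>n. R\<Phi> (X n)) \<longlonglongrightarrow> 0"
    using filterlim_compose[OF second_order_taylor[OF \<Phi>' \<Phi>''] X_lim] by (simp add: R\<Phi>_def)
  have f_exp: "f (X n) = f xbar + t n * f' xbar (W n) + (t n)\<^sup>2 * (f'' (W n) (W n) / 2 + Rf (X n))" for n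
    using t_pos[of n] unfolding Rf_def t_def[symmetric, THEN fun_cong] unfolding X_W
    by (simp add: blinfun.scaleR_right blinfun.scaleR_left power2_eq_square field_simps)
  have \<Phi>_exp: "\<Phi> (X n) = \<Phi> xbar + t n *\<^sub>R \<Phi>' xbar (W n) + (t n)\<^sup>2 *\<^sub>R ((1/2) *\<^sub>R \<Phi>'' (W n) (W n) + R\<Phi> (X n))" for n
    using t_pos[of n] unfolding R\<Phi>_def t_def[symmetric, THEN fun_cong] unfolding X_W
    by (simp add: blinfun.scaleR_right blinfun.scaleR_left power2_eq_square algebra_simps)
  \<comment> \<open>Here \<open>a\<close> is the second-order part of the Lagrangian for
    \<open>Lm n\<close>, with remainders, minus the growth modulus; \<open>u\<close> is the
    direction leading to \<open>q n\<close>, and \<open>p\<close> is the infeasibility relative to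
    \<open>t n\<close>.\<close>
  define a where "a = (\<lambda>n. (f'' (W n) (W n) + Lm n \<bullet> \<Phi>'' (W n) (W n)) / 2 + Rf (X n) + Lm n \<bullet> R\<Phi> (X n) - e n)"
  define u where "u = (\<lambda>n. (q n - \<Phi> xbar) /\<^sub>R t n)"
  define p where "p = (\<lambda>n. (\<Phi> (X n) - q n) /\<^sub>R t n)"
  have q_u: "q n = \<Phi> xbar + t n *\<^sub>R u n" for n
    using t_pos[of n] by (simp add: u_def)
  have p_eq: "\<Phi> (X n) - q n = t n *\<^sub>R p n" for n
    using t_pos[of n] by (simp add: p_def)
  \<comment> \<open>The violated growth inequality divided by the square of \<open>t n\<close>;
    stationarity removes the first-order terms.\<close>
  have ineq: "a n - Lm n \<bullet> u n / t n + 1 / (2 * e n) * (norm (p n))\<^sup>2 < 0" for n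
  proof -
    have "f' xbar (W n) + Lm n \<bullet> \<Phi>' xbar (W n) = 0"
      using stationary seq(1) by blast
    then have st: "t n * f' xbar (W n) + t n * (Lm n \<bullet> \<Phi>' xbar (W n)) = 0"
      by (simp flip: distrib_left)
    have "f (X n) + Lm n \<bullet> (\<Phi> (X n) - q n) - f xbar - e n * (t n)\<^sup>2 = (t n)\<^sup>2 * a n - t n * (Lm n \<bullet> u n)"
      unfolding f_exp \<Phi>_exp q_u a_def using st by (simp add: inner_add_right algebra_simps)
    moreover have "(norm (\<Phi> (X n) - q n))\<^sup>2 = (t n)\<^sup>2 * (norm (p n))\<^sup>2"
      unfolding p_eq by (simp add: power_mult_distrib)
    ultimately have "(t n)\<^sup>2 * a n - t n * (Lm n \<bullet> u n) + 1 / (2 * e n) * ((t n)\<^sup>2 * (norm (p n))\<^sup>2) < 0"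
      using seq(5)[of n] unfolding t_def[symmetric, THEN fun_cong] by (simp add: t_def)
    also have "(t n)\<^sup>2 * a n - t n * (Lm n \<bullet> u n) + 1 / (2 * e n) * ((t n)\<^sup>2 * (norm (p n))\<^sup>2)
        = (t n)\<^sup>2 * (a n - Lm n \<bullet> u n / t n + 1 / (2 * e n) * (norm (p n))\<^sup>2)"
      using t_pos[of n] e_pos[of n] by (simp add: power2_eq_square field_simps)
    finally show ?thesis
      using t_pos[of n] by (simp add: mult_less_0_iff)
  qed
  have u_slope: "Lm n \<bullet> u n \<le> 0" for n
    using slope[of n] t_pos[of n] by (simp add: u_def mult_nonneg_nonpos)
  define h where "h = f'' w w + lambar \<bullet> \<Phi>'' w w"
  note lims = sub[OF Lm_lim] sub[OF t_lim] sub[OF e_lim] sub[OF Rf_lim] sub[OF R\<Phi>_lim] W_lim[unfolded comp_def]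
  have a_lim: "(\<lambda>n. a (r n)) \<longlonglongrightarrow> h / 2"
    unfolding a_def h_def by (rule tendsto_eq_intros lims refl | simp)+
  \<comment> \<open>The multiplier term has a favourable sign, so the squared norm of
    \<open>p n\<close> is at most \<open>- 2 * e n * a n\<close>, where \<open>a\<close> converges
    along \<open>r\<close> and \<open>e\<close> vanishes.\<close>
  have p_lim: "(\<lambda>n. p (r n)) \<longlonglongrightarrow> 0"
  proof -
    have bound: "(norm (p n))\<^sup>2 \<le> - 2 * e n * a n" for n
    proof -
      have "1 / (2 * e n) * (norm (p n))\<^sup>2 \<le> - a n"
        using ineq[of n] divide_nonpos_pos[OF u_slope[of n] t_pos[of n]] by linarith
      then show ?thesis
        using e_pos[of n] by (simp add: field_simps)
    qed
    have "(\<lambda>n. - 2 * e (r n) * a (r n)) \<longlonglongrightarrow> - 2 * 0 * (h / 2)"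
      by (intro tendsto_intros lims a_lim)
    then have upper: "(\<lambda>n. - 2 * e (r n) * a (r n)) \<longlonglongrightarrow> 0"
      by simp
    have "(\<lambda>n. (norm (p (r n)))\<^sup>2) \<longlonglongrightarrow> 0"
      by (rule tendsto_sandwich[OF always_eventually always_eventually tendsto_const upper])
        (use bound in auto)
    then have "(\<lambda>n. sqrt ((norm (p (r n)))\<^sup>2)) \<longlonglongrightarrow> sqrt 0"
      by (rule tendsto_real_sqrt)
    then have "(\<lambda>n. norm (p (r n))) \<longlonglongrightarrow> 0"
      by simp
    then show ?thesis
      by (rule tendsto_norm_zero_cancel)
  qed
  have u_lim: "(\<lambda>n. u (r n)) \<longlonglongrightarrow> \<Phi>' xbar w"
  proof -
    have "u n = \<Phi>' xbar (W n) + t n *\<^sub>R ((1/2) *\<^sub>R \<Phi>'' (W n) (W n) + R\<Phi> (X n)) - p n" for n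
      using t_pos[of n] unfolding u_def p_def \<Phi>_exp
      by (simp add: algebra_simps power2_eq_square)
    then show ?thesis
      by (simp only:) (rule tendsto_eq_intros lims p_lim refl | simp)+
  qed
  \<comment> \<open>Criticality: \<open>Lm n \<bullet> u n\<close> is squeezed between
    \<open>t n * a n\<close> and 0, both of which vanish along \<open>r\<close>.\<close>
  have "lambar \<bullet> \<Phi>' xbar w = 0"
  proof -
    have bound: "t n * a n \<le> Lm n \<bullet> u n" for n
    proof -
      have "a n - Lm n \<bullet> u n / t n \<le> 0"
        using ineq[of n] e_pos[of n] by (smt (verit) divide_nonneg_pos mult_nonneg_nonneg zero_le_power2)
      then show ?thesis
        using t_pos[of n] by (simp add: field_simps)
    qed
    have "(\<lambda>n. t (r n) * a (r n)) \<longlonglongrightarrow> 0 * (h / 2)"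
      by (intro tendsto_intros lims a_lim)
    then have lower: "(\<lambda>n. t (r n) * a (r n)) \<longlonglongrightarrow> 0"
      by simp
    have "(\<lambda>n. Lm (r n) \<bullet> u (r n)) \<longlonglongrightarrow> 0"
      by (rule tendsto_sandwich[OF always_eventually always_eventually lower tendsto_const])
        (use bound u_slope in auto)
    moreover have "(\<lambda>n. Lm (r n) \<bullet> u (r n)) \<longlonglongrightarrow> lambar \<bullet> \<Phi>' xbar w"
      by (intro tendsto_intros lims u_lim)
    ultimately show ?thesis
      by (rule LIMSEQ_unique[symmetric])
  qed
  moreover have "\<Phi>' xbar w \<in> tangent_cone Q (\<Phi> xbar)"
    unfolding tangent_cone_def
    using t_pos lims(2) u_lim seq(4)[unfolded q_u]
    by (intro CollectI exI[of _ "\<lambda>n. t (r n)"] exI[of _ "\<lambda>n. u (r n)"]) auto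
  ultimately have "ereal h + second_subderiv (ind_fun Q) (\<Phi> xbar) lambar (\<Phi>' xbar w) > 0"
    using sosc[OF \<open>w \<noteq> 0\<close>] by (simp add: critical_cone_def h_def)
  then have "ereal (- h) < second_subderiv (ind_fun Q) (\<Phi> xbar) lambar (\<Phi>' xbar w)"
    by (cases "second_subderiv (ind_fun Q) (\<Phi> xbar) lambar (\<Phi>' xbar w)") auto
  \<comment> \<open>A real number strictly below the second subderivative bounds the difference
    quotients eventually, even if the subderivative is infinite.\<close>
  then obtain c where c: "- h < c"
    and c_less: "ereal c < second_subderiv (ind_fun Q) (\<Phi> xbar) lambar (\<Phi>' xbar w)"
    using ereal_dense2 by (metis less_ereal.simps(1))
  have "filterlim (\<lambda>n. (t (r n), u (r n))) (at_right 0 \<times>\<^sub>F nhds (\<Phi>' xbar w)) sequentially"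
    using lims(2) t_pos u_lim by (intro filterlim_Pair tendsto_imp_filterlim_at_right) auto
  then have "\<forall>\<^sub>F n in sequentially. ereal c < (case (t (r n), u (r n)) of (t, w') \<Rightarrow>
      (ind_fun Q (\<Phi> xbar + t *\<^sub>R w') - ind_fun Q (\<Phi> xbar) - ereal (t * (lambar \<bullet> w'))) / ereal (t\<^sup>2 / 2))"
    using less_LiminfD[OF c_less[unfolded second_subderiv_def]] by (rule eventually_compose_filterlim[rotated])
  \<comment> \<open>The points \<open>\<Phi> xbar + t (r n) *\<^sub>R u (r n)\<close> are the
    \<open>q (r n)\<close> in \<open>Q\<close>, so both indicator terms vanish and only the linear
    term of the quotient remains.\<close>
  then have quot: "\<forall>\<^sub>F n in sequentially. c / 2 < - (lambar \<bullet> u (r n)) / t (r n)"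
  proof (rule eventually_mono)
    fix n
    have "t (r n) > 0" and "\<Phi> xbar + t (r n) *\<^sub>R u (r n) \<in> Q"
      using t_pos seq(4)[of "r n"] by (auto simp: q_u)
    moreover assume "ereal c < (case (t (r n), u (r n)) of (t, w') \<Rightarrow>
      (ind_fun Q (\<Phi> xbar + t *\<^sub>R w') - ind_fun Q (\<Phi> xbar) - ereal (t * (lambar \<bullet> w'))) / ereal (t\<^sup>2 / 2))"
    ultimately show "c / 2 < - (lambar \<bullet> u (r n)) / t (r n)"
      using Q by (simp add: ind_fun_def power2_eq_square field_simps)
  qed
  \<comment> \<open>Testing the normal vector from \<open>extend\<close> on
    \<open>q n - \<Phi> xbar\<close> gives \<open>Lm n \<bullet> u n \<le> (1 - \<delta>) * (lambar
    \<bullet> u n)\<close>. Thus \<open>quot\<close>, a bound for \<open>lambar\<close>, carries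
    over to \<open>Lm n\<close> with the factor \<open>1 - \<delta>\<close>, and \<open>ineq\<close>
    passes to the limit.\<close>
  have "h / 2 + (1 - \<delta>) * (c / 2) \<le> 0" if \<delta>: "0 < \<delta>" "\<delta> < 1" for \<delta>
  proof -
    have "\<forall>\<^sub>F n in sequentially. Lm (r n) - (1 - \<delta>) *\<^sub>R lambar \<in> normal_cone Q (\<Phi> xbar)"
      using eventually_compose_filterlim[OF extend[OF \<delta>] lims(1)] seq(1) by simp
    with quot have "\<forall>\<^sub>F n in sequentially. a (r n) + (1 - \<delta>) * (c / 2) \<le> 0"
    proof eventually_elim
      case (elim n)
      let ?m = "r n"
      have "(Lm ?m - (1 - \<delta>) *\<^sub>R lambar) \<bullet> (t ?m *\<^sub>R u ?m) \<le> 0"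
        using elim(2) seq(4)[of ?m] unfolding normal_cone_def q_u by force
      then have "Lm ?m \<bullet> u ?m \<le> (1 - \<delta>) * (lambar \<bullet> u ?m)"
        using t_pos[of ?m] by (simp add: inner_diff_left mult_le_0_iff)
      then have "Lm ?m \<bullet> u ?m / t ?m \<le> (1 - \<delta>) * (lambar \<bullet> u ?m) / t ?m"
        using t_pos[of ?m] by (simp add: divide_right_mono)
      moreover have "(1 - \<delta>) * (c / 2) \<le> (1 - \<delta>) * (- (lambar \<bullet> u ?m) / t ?m)"
        using elim(1) \<delta> by (intro mult_left_mono) auto
      moreover have "1 / (2 * e ?m) * (norm (p ?m))\<^sup>2 \<ge> 0"
        using e_pos[of ?m] by simp
      ultimately show ?case
        using ineq[of ?m] by simp
    qed
    moreover have "(\<lambda>n. a (r n) + (1 - \<delta>) * (c / 2)) \<longlonglongrightarrow> h / 2 + (1 - \<delta>) * (c / 2)"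
      by (intro tendsto_intros a_lim)
    ultimately show ?thesis
      by (intro tendsto_upperbound[where F = sequentially]) auto
  qed
  \<comment> \<open>Letting \<open>\<delta>\<close> tend to 0 yields \<open>h + c \<le> 0\<close>,
    against the choice of \<open>c\<close>.\<close>
  moreover have "((\<lambda>\<delta>. h / 2 + (1 - \<delta>) * (c / 2)) \<longlongrightarrow> h / 2 + (1 - 0) * (c / 2)) (at_right 0)"
    by (intro tendsto_intros)
  moreover have "\<forall>\<^sub>F \<delta> in at_right (0::real). 0 < \<delta> \<and> \<delta> < 1"
    by (auto simp: eventually_at_right_field intro: exI[of _ 1])
  ultimately have "h / 2 + (1 - 0) * (c / 2) \<le> 0"
    by (intro tendsto_upperbound[where F = "at_right 0"]) (auto elim: eventually_mono)
  then show False
    using c by simp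
qed

section \<open>Transfer to the Lagrangian and choice of the constants\<close>

theorem theorem4p5:
  fixes f :: "real ^ 'n \<Rightarrow> real"
    and \<Phi> :: "real ^ 'n \<Rightarrow> real \<times> (real ^ 'm)"
    and xbar :: "real ^ 'n"
    and lambar :: "real \<times> (real ^ 'm)"
  assumes "C2_around f xbar"
    and "C2_around \<Phi> xbar"
    and "KKT f \<Phi> xbar lambar"
    and "SOSC f \<Phi> xbar lambar"
    and "polyhedron (multipliers f \<Phi> xbar) \<or> lambar \<in> interior (uminus ` soc)"
  shows "\<exists>\<rho>0>0. \<exists>\<gamma>>0. \<exists>\<epsilon>>0. \<exists>l>0.
           \<forall>lam \<in> multipliers f \<Phi> xbar \<inter> cball lambar \<epsilon>. \<forall>\<rho>\<ge>\<rho>0. \<forall>x \<in> cball xbar \<gamma>.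
             aug_lagrangian f \<Phi> x lam \<rho> \<ge> f xbar + l * (norm (x - xbar))\<^sup>2"
proof -
  obtain f' f'' where f': "\<forall>\<^sub>F y in nhds xbar. (f has_derivative blinfun_apply (f' y)) (at y)"
    and f'': "(f' has_derivative blinfun_apply f'') (at xbar)"
    using C2_aroundE[OF assms(1)] by blast
  obtain \<Phi>' \<Phi>'' where \<Phi>': "\<forall>\<^sub>F y in nhds xbar. (\<Phi> has_derivative blinfun_apply (\<Phi>' y)) (at y)"
    and \<Phi>'': "(\<Phi>' has_derivative blinfun_apply \<Phi>'') (at xbar)"
    using C2_aroundE[OF assms(2)] by blast
  have jac: "jacobian \<Phi> xbar = blinfun_apply (\<Phi>' xbar)"
    using frechet_derivative_at[OF eventually_nhds_x_imp_x[OF \<Phi>']] by simp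
  \<comment> \<open>The derivative of the Lagrangian in \<open>x\<close> as a bounded linear map; it
    expresses the gradient and Hessian in the definitions through the derivatives of
    \<open>f\<close> and \<open>\<Phi>\<close>.\<close>
  define L' where "L' = (\<lambda>lam y. f' y + (blinfun_inner_left lam o\<^sub>L \<Phi>' y))"
  have L': "\<forall>\<^sub>F y in nhds xbar. ((\<lambda>x. lagrangian f \<Phi> x lam) has_derivative blinfun_apply (L' lam y)) (at y)" for lam
    using f' \<Phi>'
  proof eventually_elim
    case (elim y)
    then show ?case
      unfolding lagrangian_def L'_def
      by (auto intro!: derivative_eq_intros simp: blinfun.add_left inner_commute)
  qed
  have L'': "(L' lam has_derivative (\<lambda>v. f'' v + (blinfun_inner_left lam o\<^sub>L \<Phi>'' v))) (at xbar)" for lam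
    unfolding L'_def
    by (intro has_derivative_add f'' bounded_linear.has_derivative[OF _ \<Phi>'']
        bounded_bilinear.bounded_linear_right[OF bounded_bilinear_blinfun_compose])
  have grad_L: "v \<bullet> grad (\<lambda>x. lagrangian f \<Phi> x lam) xbar = f' xbar v + lam \<bullet> \<Phi>' xbar v" for lam v
    using inner_grad[OF eventually_nhds_x_imp_x[OF L']]
    by (simp add: L'_def blinfun.add_left inner_commute)
  have hess_L: "hessian (\<lambda>x. lagrangian f \<Phi> x lam) xbar v \<bullet> v = f'' v v + lam \<bullet> \<Phi>'' v v" for lam v
    using inner_hessian[OF L' L'', of v lam v]
    by (simp add: blinfun.add_left inner_commute)
  define M where "M = multipliers f \<Phi> xbar"
  have stationary: "f' xbar v + lam \<bullet> \<Phi>' xbar v = 0" if "lam \<in> M" for lam v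
    using that grad_L[of v lam] by (simp add: M_def multipliers_def)
  have normal: "M \<subseteq> normal_cone soc (\<Phi> xbar)"
    by (auto simp: M_def multipliers_def)
  have lambar: "lambar \<in> normal_cone soc (\<Phi> xbar)"
    using assms(3) by (simp add: KKT_def)
  \<comment> \<open>\<open>KKT\<close> is phrased with the adjoint Jacobian,
    \<open>multipliers\<close> with the gradient of the Lagrangian. Both agree when paired with
    every \<open>v\<close>, which puts \<open>lambar\<close> in \<open>M\<close>, the base point
    needed for the polyhedral alternative.\<close>
  have "v \<bullet> grad (\<lambda>x. lagrangian f \<Phi> x lambar) xbar = 0" for v
  proof -
    have "v \<bullet> (grad f xbar + adjoint (jacobian \<Phi> xbar) lambar) = f' xbar v + lambar \<bullet> \<Phi>' xbar v"
      using inner_grad[OF eventually_nhds_x_imp_x[OF f']]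
        adjoint_works[OF bounded_linear.linear[OF blinfun.bounded_linear_right], of v "\<Phi>' xbar" lambar]
      by (simp add: inner_add_right jac inner_commute)
    then show ?thesis
      using assms(3) by (simp add: grad_L KKT_def)
  qed
  then have "grad (\<lambda>x. lagrangian f \<Phi> x lambar) xbar = 0"
    using inner_eq_zero_iff by blast
  then have "lambar \<in> M"
    using lambar by (simp add: M_def multipliers_def)
  have "\<exists>e>0. \<forall>lam \<in> M \<inter> cball lambar e. \<forall>x \<in> cball xbar e. \<forall>q \<in> soc.
      f x + lam \<bullet> (\<Phi> x - q) + 1 / (2 * e) * (norm (\<Phi> x - q))\<^sup>2 \<ge> f xbar + e * (norm (x - xbar))\<^sup>2"
  proof (rule uniform_growth[OF f' f'' \<Phi>' \<Phi>'' _ stationary normal])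
    show "\<Phi> xbar \<in> soc"
      using lambar by (simp add: normal_cone_def)
    show "ereal (f'' w w + lambar \<bullet> \<Phi>'' w w)
        + second_subderiv (ind_fun soc) (\<Phi> xbar) lambar (\<Phi>' xbar w) > 0"
      if "w \<noteq> 0" "\<Phi>' xbar w \<in> critical_cone soc (\<Phi> xbar) lambar" for w
      using assms(4) that by (simp add: SOSC_def jac hess_L)
    show "\<forall>\<^sub>F lam in nhds lambar. lam \<in> M \<longrightarrow> lam - (1 - \<delta>) *\<^sub>R lambar \<in> normal_cone soc (\<Phi> xbar)"
      if "0 < \<delta>" for \<delta> :: real
      using assms(5)
    proof
      assume "polyhedron (multipliers f \<Phi> xbar)"
      then show ?thesis
        using normal_cone_extend_polyhedron[OF _ normal \<open>lambar \<in> M\<close> that] by (simp add: M_def)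
    next
      assume "lambar \<in> interior (uminus ` soc)"
      from normal_cone_extend_soc[OF lambar this that] show ?thesis
        by (rule eventually_mono) blast
    qed
  qed
  then obtain e where "e > 0" and growth: "\<And>lam x q. lam \<in> M \<inter> cball lambar e \<Longrightarrow> x \<in> cball xbar e \<Longrightarrow> q \<in> soc \<Longrightarrow>
      f x + lam \<bullet> (\<Phi> x - q) + 1 / (2 * e) * (norm (\<Phi> x - q))\<^sup>2 \<ge> f xbar + e * (norm (x - xbar))\<^sup>2"
    by blast
  \<comment> \<open>The threshold for \<open>\<rho>\<close> is \<open>1 / e\<close>: beyond it the
    penalty at the attaining \<open>q\<close> dominates the one with coefficient
    \<open>1 / (2 * e)\<close>. The other three constants all equal \<open>e\<close>.\<close>
  have "aug_lagrangian f \<Phi> x lam \<rho> \<ge> f xbar + e * (norm (x - xbar))\<^sup>2"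
    if "lam \<in> M \<inter> cball lambar e" "\<rho> \<ge> 1 / e" "x \<in> cball xbar e" for lam \<rho> x
  proof -
    have "\<rho> > 0"
      using \<open>e > 0\<close> that(2) by (meson divide_pos_pos less_le_trans zero_less_one)
    then obtain q where q: "q \<in> soc"
      "aug_lagrangian f \<Phi> x lam \<rho> = f x + lam \<bullet> (\<Phi> x - q) + \<rho> / 2 * (norm (\<Phi> x - q))\<^sup>2"
      by (rule aug_lagrangian_attained)
    have "1 / (2 * e) * (norm (\<Phi> x - q))\<^sup>2 \<le> \<rho> / 2 * (norm (\<Phi> x - q))\<^sup>2"
      using that(2) \<open>e > 0\<close> by (intro mult_right_mono) (auto simp: field_simps)
    then show ?thesis
      using growth[OF that(1,3) q(1)] q(2) by linarith
  qed
  then show ?thesis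
    using \<open>e > 0\<close> unfolding M_def
    by (intro exI[of _ "1 / e"] exI[of _ e] conjI) auto
qed

end
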